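(* Let $h:\mathbb{R}^n\to\mathbb{R}\cup\{+\infty\}$ be a kernel function, let $S\subseteq\operatorname{int}\operatorname{dom}(h)$ be a nonempty, convex and open set, and let $\rho>0$. Then, for a proper function $\varphi:\mathbb{R}^n\to\mathbb{R}\cup\{+\infty\}$, the following assertions are equivalent: (a) $\varphi$ is $\rho$-weakly convex relative to $h$ on $S$; (b) $\varphi(y)\ge\varphi(x)+\langle\zeta,y-x\rangle-\rho D_h(y,x)$ for any $x,y\in S$ and any $\zeta\in\partial\varphi(x)$; (c) $\langle\zeta-\eta,x-y\rangle\ge-\rho\langle\nabla h(x)-\nabla h(y),x-y\rangle$ for any $x,y\in S$, any $\zeta\in\partial\varphi(x)$ and any $\eta\in\partial\varphi(y)$; (d) $\nabla^2\varphi(x)\succeq-\rho\nabla^2h(x)$ for any $x\in S$, provided that $\varphi,h\in\mathcal{C}^2(S)$.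
   Context: A kernel function is a proper, lower semicontinuous, convex function $h:\mathbb{R}^n\to\mathbb{R}\cup\{+\infty\}$ with $\operatorname{int}\operatorname{dom}(h)\neq\emptyset$ that is continuously differentiable on $\operatorname{int}\operatorname{dom}(h)$. Its Bregman distance is $D_h(x,y)=h(x)-h(y)-\langle\nabla h(y),x-y\rangle$ if $y\in\operatorname{int}\operatorname{dom}(h)$, and $+\infty$ otherwise. A function $\varphi$ is $\rho$-weakly convex relative to $h$ on a nonempty convex set $S$ if $\varphi+\rho h$ is convex on $S$. For a proper function $\varphi$ that is locally Lipschitz at $x\in\operatorname{dom}(\varphi)$, $\partial\varphi(x)$ denotes the Fréchet subdifferential: the set of $\zeta\in\mathbb{R}^n$ with $\varphi(y)\ge\varphi(x)+\langle\zeta,y-x\rangle+o(\|y-x\|)$ as $y\to x$.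
   Formalization: φ is additionally assumed locally Lipschitz (hence finite) at every x in S: ∂φ(x) is defined only at such points, and without this the equivalence fails, e.g. for φ = 0 on the rationals and 1 on the irrationals with h = |x|²/2, S = ℝ. *)

theory Defs
  imports "HOL-Analysis.Analysis" "HOL-Library.Landau_Symbols"
begin

text \<open>
  Functions with values in \<open>(-\<infinity>, \<infinity>]\<close> are functions into \<^typ>\<open>ereal\<close>; the value
  \<open>-\<infinity>\<close> is excluded by properness.
\<close>

definition edom :: "('a \<Rightarrow> ereal) \<Rightarrow> 'a set"
  where "edom f = {x. f x < \<infinity>}"

definition proper :: "('a \<Rightarrow> ereal) \<Rightarrow> bool"
  where "proper f \<longleftrightarrow> (\<forall>x. f x \<noteq> -\<infinity>) \<and> edom f \<noteq> {}"

definition lsc :: "('a::topological_space \<Rightarrow> ereal) \<Rightarrow> bool"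
  where "lsc f \<longleftrightarrow> (\<forall>x. f x \<le> Liminf (at x) f)"

text \<open>
  The counterpart of \<^const>\<open>convex_on\<close> for extended-real values. The convention
  \<open>0 * \<infinity> = 0\<close> of \<^typ>\<open>ereal\<close> makes the weights \<open>u = 0\<close> and \<open>v = 0\<close> harmless.
\<close>

definition econvex_on :: "'a::real_vector set \<Rightarrow> ('a \<Rightarrow> ereal) \<Rightarrow> bool"
  where "econvex_on S f \<longleftrightarrow> convex S \<and>
    (\<forall>x\<in>S. \<forall>y\<in>S. \<forall>u\<ge>0. \<forall>v\<ge>0. u + v = 1 \<longrightarrow>
      f (u *\<^sub>R x + v *\<^sub>R y) \<le> ereal u * f x + ereal v * f y)"

text \<open>
  Derivatives are those of the real-valued representative. As \<^const>\<open>real_of_ereal\<close>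
  sends \<open>\<infinity>\<close> to \<open>0\<close>, they are meaningful only in the interior of the domain.
\<close>

definition grad :: "(real^'n \<Rightarrow> ereal) \<Rightarrow> real^'n \<Rightarrow> real^'n"
  where "grad f x = (THE g. GDERIV (\<lambda>y. real_of_ereal (f y)) x :> g)"

definition hessian :: "(real^'n \<Rightarrow> ereal) \<Rightarrow> real^'n \<Rightarrow> real^'n^'n"
  where "hessian f x = jacobian (grad f) (at x)"

text \<open>Both notions of smoothness are intended for open \<open>S\<close>.\<close>

definition C1_on :: "(real^'n \<Rightarrow> ereal) \<Rightarrow> (real^'n) set \<Rightarrow> bool"
  where "C1_on f S \<longleftrightarrow> S \<subseteq> edom f \<and>
    (\<forall>x\<in>S. (\<lambda>y. real_of_ereal (f y)) differentiable (at x)) \<and>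
    continuous_on S (grad f)"

definition C2_on :: "(real^'n \<Rightarrow> ereal) \<Rightarrow> (real^'n) set \<Rightarrow> bool"
  where "C2_on f S \<longleftrightarrow> C1_on f S \<and>
    (\<forall>x\<in>S. grad f differentiable (at x)) \<and>
    continuous_on S (hessian f)"

text \<open>
  The Loewner order. It is applied to Hessians of twice continuously differentiable
  functions, which are symmetric, so symmetry is not made part of the definition.
\<close>

definition loewner_ge :: "real^'n^'n \<Rightarrow> real^'n^'n \<Rightarrow> bool"  (infix \<open>\<succeq>\<^sub>L\<close> 50)
  where "A \<succeq>\<^sub>L B \<longleftrightarrow> (\<forall>v. 0 \<le> v \<bullet> ((A - B) *v v))"

definition kernel_function :: "(real^'n \<Rightarrow> ereal) \<Rightarrow> bool"
  where "kernel_function h \<longleftrightarrow> proper h \<and> lsc h \<and> econvex_on UNIV h \<and>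
    interior (edom h) \<noteq> {} \<and> C1_on h (interior (edom h))"

definition bregman :: "(real^'n \<Rightarrow> ereal) \<Rightarrow> real^'n \<Rightarrow> real^'n \<Rightarrow> ereal"
  where "bregman h x y =
    (if y \<in> interior (edom h) then h x - h y - ereal (grad h y \<bullet> (x - y)) else \<infinity>)"

definition weakly_convex_rel ::
    "real \<Rightarrow> (real^'n \<Rightarrow> ereal) \<Rightarrow> (real^'n) set \<Rightarrow> (real^'n \<Rightarrow> ereal) \<Rightarrow> bool"
  where "weakly_convex_rel \<rho> h S \<phi> \<longleftrightarrow> econvex_on S (\<lambda>x. \<phi> x + ereal \<rho> * h x)"

text \<open>In particular, \<open>f\<close> is finite near \<open>x\<close>.\<close>

definition locally_lipschitz_at :: "(real^'n \<Rightarrow> ereal) \<Rightarrow> real^'n \<Rightarrow> bool"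
  where "locally_lipschitz_at f x \<longleftrightarrow>
    (\<exists>U L. open U \<and> x \<in> U \<and> (\<forall>y\<in>U. \<bar>f y\<bar> \<noteq> \<infinity>) \<and> L-lipschitz_on U (\<lambda>y. real_of_ereal (f y)))"

definition frechet_subdiff :: "(real^'n \<Rightarrow> ereal) \<Rightarrow> real^'n \<Rightarrow> (real^'n) set"
  where "frechet_subdiff f x = {\<zeta>. x \<in> edom f \<and>
    (\<exists>r :: real^'n \<Rightarrow> real. r \<in> o[at x](\<lambda>y. norm (y - x)) \<and>
      (\<forall>\<^sub>F y in at x. f y \<ge> f x + ereal (\<zeta> \<bullet> (y - x)) + ereal (r y)))}"

end

theory Submission
  imports Defs
begin

text \<open>
  Put \<open>P = \<phi> + \<rho> h\<close>, so that (a) says that \<open>P\<close> is convex on \<open>S\<close>, and the Frechet subgradients of \<open>P\<close> at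
  \<open>x\<close> are the vectors \<open>\<zeta> + \<rho> \<nabla>h(x)\<close> with \<open>\<zeta> \<in> \<partial>\<phi>(x)\<close>. Then (b) is the subgradient inequality for \<open>P\<close> and (c)
  the monotonicity of its subdifferential. The implication from (c) to (a) is the hard one. If \<open>P\<close> lies
  strictly above its chord at a point \<open>c\<close> of a segment \<open>[a, b]\<close>, an approximate mean value theorem on
  \<open>[a, c]\<close> and on \<open>[b, c]\<close> yields subgradients near the two pieces whose components along \<open>b - a\<close>
  violate monotonicity. In the smooth case the subdifferential is the gradient, whose monotonicity
  is equivalent to the Hessian being positive semidefinite.
\<close>

section \<open>Frechet subgradients of real-valued functions\<close>

text \<open>The little-o remainder is encoded as a slack \<open>e\<close>, and values are real, so
  that subgradients add without \<open>ereal\<close> arithmetic.\<close>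

definition fsubgrad :: "('a::real_inner \<Rightarrow> real) \<Rightarrow> 'a \<Rightarrow> 'a \<Rightarrow> bool"
  where "fsubgrad f x \<zeta> \<longleftrightarrow>
    (\<forall>e>0. \<forall>\<^sub>F y in at x. f x + \<zeta> \<bullet> (y - x) - e * norm (y - x) \<le> f y)"

lemma fsubgrad_add:
  assumes "fsubgrad f x \<zeta>" and "fsubgrad g x \<eta>"
  shows "fsubgrad (\<lambda>y. f y + g y) x (\<zeta> + \<eta>)"
  unfolding fsubgrad_def
proof (intro allI impI)
  fix e :: real
  assume "e > 0"
  then have "\<forall>\<^sub>F y in at x. f x + \<zeta> \<bullet> (y - x) - e / 2 * norm (y - x) \<le> f y"
    and "\<forall>\<^sub>F y in at x. g x + \<eta> \<bullet> (y - x) - e / 2 * norm (y - x) \<le> g y"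
    using assms half_gt_zero unfolding fsubgrad_def by blast+
  then show "\<forall>\<^sub>F y in at x. f x + g x + (\<zeta> + \<eta>) \<bullet> (y - x) - e * norm (y - x) \<le> f y + g y"
    by eventually_elim (simp add: inner_add_left)
qed

lemma GDERIV_imp_fsubgrad:
  assumes "GDERIV f x :> g"
  shows "fsubgrad f x g"
  unfolding fsubgrad_def
proof (intro allI impI)
  fix e :: real
  assume "e > 0"
  then obtain d where "d > 0" and
    d: "\<And>y. norm (y - x) < d \<Longrightarrow> norm (f y - f x - (y - x) \<bullet> g) \<le> e * norm (y - x)"
    using assms unfolding gderiv_def has_derivative_at_alt by metis
  have "f x + g \<bullet> (y - x) - e * norm (y - x) \<le> f y" if "norm (y - x) < d" for y
    using d[OF that] by (auto simp: abs_le_iff inner_commute)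
  then show "\<forall>\<^sub>F y in at x. f x + g \<bullet> (y - x) - e * norm (y - x) \<le> f y"
    using \<open>d > 0\<close> by (auto simp: eventually_at dist_norm)
qed

text \<open>Convexity scales increments along the segment from \<open>x\<close> to \<open>y\<close>,
  so the local inequality at a point close to \<open>x\<close> extends to \<open>y\<close>.\<close>

lemma fsubgrad_convex_above_tangent:
  assumes "convex_on S f" and "x \<in> S" and "y \<in> S" and sub: "fsubgrad f x \<zeta>"
  shows "f x + \<zeta> \<bullet> (y - x) \<le> f y"
proof (cases "y = x")
  case False
  define d where "d = y - x"
  have nd: "norm d > 0"
    using False by (simp add: d_def)
  have "f x + \<zeta> \<bullet> d \<le> f y + e" if "e > 0" for e
  proof -
    \<comment> \<open>The slack \<open>e / norm d\<close> becomes an error of exactly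
      \<open>t * e\<close> at \<open>x + t *\<^sub>R d\<close>, so that the factor \<open>t\<close>
      cancels at the end.\<close>
    have "\<forall>\<^sub>F z in at x. f x + \<zeta> \<bullet> (z - x) - e / norm d * norm (z - x) \<le> f z"
      using sub[unfolded fsubgrad_def, rule_format, of "e / norm d"] that nd by simp
    then obtain r where "r > 0" and
      r: "\<And>z. z \<noteq> x \<Longrightarrow> dist z x < r \<Longrightarrow> f x + \<zeta> \<bullet> (z - x) - e / norm d * norm (z - x) \<le> f z"
      by (auto simp: eventually_at)
    define t where "t = min 1 (r / (2 * norm d))"
    have t: "0 < t" "t \<le> 1"
      using \<open>r > 0\<close> nd by (auto simp: t_def)
    have "t * norm d \<le> r / (2 * norm d) * norm d"
      by (intro mult_right_mono) (auto simp: t_def)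
    also have "\<dots> < r"
      using nd \<open>r > 0\<close> by simp
    finally have "dist (x + t *\<^sub>R d) x < r"
      using t by (simp add: dist_norm)
    then have "f x + t * (\<zeta> \<bullet> d) - t * e \<le> f (x + t *\<^sub>R d)"
      using r[of "x + t *\<^sub>R d"] t nd by (simp add: mult.commute)
    also have "x + t *\<^sub>R d = (1 - t) *\<^sub>R x + t *\<^sub>R y"
      by (simp add: d_def algebra_simps)
    also have "f \<dots> \<le> (1 - t) * f x + t * f y"
      using convex_onD[OF assms(1), of t x y] assms t by simp
    finally have "t * (f x + \<zeta> \<bullet> d) \<le> t * (f y + e)"
      by (simp add: algebra_simps)
    then show ?thesis
      using t by simp
  qed
  then show ?thesis
    unfolding d_def by (rule field_le_epsilon)
qed simp

text \<open>Subtracting \<open>f\<close> makes \<open>\<zeta> - g\<close> a subgradient of the zero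
  function, which is convex; its tangent inequality in the direction \<open>\<zeta> - g\<close>
  forces this vector to vanish.\<close>

lemma fsubgrad_unique:
  assumes "GDERIV f x :> g" and "fsubgrad f x \<zeta>"
  shows "\<zeta> = g"
proof -
  have "GDERIV (\<lambda>y. - f y) x :> - g"
    using assms(1) by (rule GDERIV_minus)
  then have "fsubgrad (\<lambda>y. f y + - f y) x (\<zeta> + - g)"
    by (intro fsubgrad_add assms GDERIV_imp_fsubgrad)
  then have "fsubgrad (\<lambda>y. 0) x (\<zeta> - g)"
    by simp
  then have "(\<zeta> - g) \<bullet> (\<zeta> - g) \<le> 0"
    using fsubgrad_convex_above_tangent[of UNIV "\<lambda>y. 0" x "x + (\<zeta> - g)" "\<zeta> - g"]
    by (simp add: convex_on_const)
  then show ?thesis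
    by (metis inner_gt_zero_iff not_le right_minus_eq)
qed

text \<open>The subgradient is minus the gradient of the quadratic at \<open>x\<close>; the
  second-order term \<open>n * (norm (y - x))\<^sup>2\<close> is absorbed by the slack near
  \<open>x\<close>.\<close>

lemma fsubgrad_if_local_min_add_square:
  assumes "\<forall>\<^sub>F y in at x. f x + n * (norm (x - z))\<^sup>2 \<le> f y + n * (norm (y - z))\<^sup>2"
  shows "fsubgrad f x (- (2 * n) *\<^sub>R (x - z))"
  unfolding fsubgrad_def
proof (intro allI impI)
  fix e :: real
  assume "e > 0"
  then have "\<forall>\<^sub>F y in at x. dist y x < e / (\<bar>n\<bar> + 1)"
    unfolding eventually_at by (intro exI[of _ "e / (\<bar>n\<bar> + 1)"]) auto
  with assms show
    "\<forall>\<^sub>F y in at x. f x + (- (2 * n) *\<^sub>R (x - z)) \<bullet> (y - x) - e * norm (y - x) \<le> f y"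
  proof eventually_elim
    case (elim y)
    have "n * norm (y - x) \<le> (\<bar>n\<bar> + 1) * norm (y - x)"
      by (intro mult_right_mono) auto
    also have "\<dots> \<le> e"
      using elim(2) by (simp add: dist_norm pos_less_divide_eq mult.commute)
    finally have "n * (norm (y - x))\<^sup>2 \<le> e * norm (y - x)"
      by (simp add: power2_eq_square mult_right_mono flip: mult.assoc)
    moreover have "n * (norm (y - z))\<^sup>2 =
        n * (norm (x - z))\<^sup>2 + 2 * n * ((x - z) \<bullet> (y - x)) + n * (norm (y - x))\<^sup>2"
      by (simp add: power2_norm_eq_inner algebra_simps inner_commute)
    moreover have "(- (2 * n) *\<^sub>R (x - z)) \<bullet> (y - x) = - (2 * n * ((x - z) \<bullet> (y - x)))"
      by simp
    ultimately show ?case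
      using elim(1) by linarith
  qed
qed

section \<open>Approximate mean value theorem\<close>

text \<open>
  The point and the subgradient come from minimising \<open>f y - \<kappa> t + n \<bar>y - (a + t (b - a))\<bar>\<^sup>2\<close> jointly in
  \<open>y\<close> near the segment and \<open>t \<in> [0, 1]\<close>: optimality in \<open>y\<close> gives the subgradient, optimality in
  \<open>t\<close> its slope. Since \<open>\<kappa> < f b - f a\<close>, the minimum is not attained at \<open>t = 1\<close>; it may be at
  \<open>t = 0\<close>, but the slope inequality needs only larger values of \<open>t\<close>.
\<close>

lemma approximate_mean_value:
  fixes f :: "'a::euclidean_space \<Rightarrow> real"
  assumes "open S" and cont: "continuous_on S f" and seg: "closed_segment a b \<subseteq> S"
    and slope: "f a + \<kappa> < f b"
  shows "\<exists>N. \<forall>n\<ge>N. \<exists>y\<in>S. \<exists>t\<in>{0..<1}.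
    \<exists>\<zeta>. \<zeta> = - (2 * n) *\<^sub>R (y - (a + t *\<^sub>R (b - a))) \<and> fsubgrad f y \<zeta> \<and> \<kappa> \<le> \<zeta> \<bullet> (b - a)"
proof -
  define d where "d = b - a"
  have in_seg: "a + t *\<^sub>R d \<in> closed_segment a b" if "t \<in> {0..1}" for t
    using that unfolding closed_segment_def d_def
    by (auto intro!: exI[of _ t] simp: algebra_simps)
  obtain r where "r > 0" and r: "(\<Union>x\<in>closed_segment a b. cball x r) \<subseteq> S"
    using compact_subset_open_imp_cball_epsilon_subset[OF compact_segment \<open>open S\<close> seg] .
  \<comment> \<open>The closed \<open>r\<close>-neighbourhood of the segment, written in the form
    for which \<open>compact_sums'\<close> gives compactness.\<close>
  define K where "K = (\<Union>x\<in>closed_segment a b. \<Union>u\<in>cball 0 r. {x + u})"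
  have "compact K"
    unfolding K_def by (intro compact_sums' compact_segment compact_cball)
  have in_K: "y \<in> K" if "norm (y - z) \<le> r" "z \<in> closed_segment a b" for y z
    unfolding K_def using that by (intro UN_I[of z] UN_I[of "y - z"]) auto
  have K: "K \<subseteq> S"
    using r by (fastforce simp: K_def dist_norm)
  have contK: "continuous_on K f"
    using cont K continuous_on_subset by blast
  obtain B where B: "\<And>y. y \<in> K \<Longrightarrow> \<bar>f y\<bar> \<le> B"
    using compact_imp_bounded[OF compact_continuous_image[OF contK \<open>compact K\<close>]]
    by (auto simp: bounded_iff)
  have "b \<in> S"
    using seg by auto
  then have "\<forall>\<^sub>F y in at b. f a + \<kappa> < f y"
    using cont \<open>open S\<close> slope
    by (metis continuous_on_eq_continuous_at isCont_def order_tendstoD(1))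
  then obtain q where "q > 0" and q: "\<And>y. dist y b < q \<Longrightarrow> f a + \<kappa> < f y"
    using slope unfolding eventually_at by (metis UNIV_I)
  \<comment> \<open>Distance below \<open>r\<close> from the segment leaves room to vary
    \<open>y\<close> inside \<open>K\<close>; distance below \<open>q\<close> from \<open>b\<close>
    keeps \<open>f\<close> above \<open>f a + \<kappa>\<close>.\<close>
  define m where "m = min r q"
  have "m > 0"
    using \<open>r > 0\<close> \<open>q > 0\<close> by (simp add: m_def)
  show ?thesis
  proof (intro exI[of _ "(2 * \<bar>B\<bar> + 1) / m\<^sup>2"] allI impI)
    fix n
    assume n: "n \<ge> (2 * \<bar>B\<bar> + 1) / m\<^sup>2"
    have "n > 0"
      using n \<open>m > 0\<close> by (smt (verit) divide_pos_pos zero_less_power)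
    define \<Phi> where "\<Phi> p = f (fst p) - \<kappa> * snd p + n * (norm (fst p - (a + snd p *\<^sub>R d)))\<^sup>2" for p
    have "continuous_on (K \<times> {0..1}) \<Phi>"
      unfolding \<Phi>_def by (intro continuous_intros continuous_on_compose2[OF contK]) auto
    moreover have "K \<times> {0..1::real} \<noteq> {}"
      using in_K[of a a] \<open>r > 0\<close> by auto
    ultimately obtain p where p: "p \<in> K \<times> {0..1}" "\<forall>p'\<in>K \<times> {0..1}. \<Phi> p \<le> \<Phi> p'"
      using continuous_attains_inf[of "K \<times> {0..1}" \<Phi>] \<open>compact K\<close>
      by (auto simp: compact_Times)
    obtain y t where yt: "p = (y, t)"
      by (cases p)
    define z where "z = a + t *\<^sub>R d"
    have yK: "y \<in> K" and t: "t \<in> {0..1}"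
      using p yt by auto
    have min: "f y - \<kappa> * t + n * (norm (y - z))\<^sup>2 \<le> f y' - \<kappa> * t' + n * (norm (y' - (a + t' *\<^sub>R d)))\<^sup>2"
      if "y' \<in> K" "t' \<in> {0..1}" for y' t'
      using p(2) that unfolding yt \<Phi>_def z_def by fastforce
    have z: "z \<in> closed_segment a b"
      unfolding z_def using t by (rule in_seg)
    then have zK: "z \<in> K"
      using in_K[of z z] \<open>r > 0\<close> by simp
    \<comment> \<open>Comparison with the pair \<open>(z, t)\<close>, whose penalty vanishes. The
      lower bound on \<open>n\<close> is chosen so that this forces
      \<open>norm (y - z) < m\<close>.\<close>
    have "n * (norm (y - z))\<^sup>2 \<le> 2 * \<bar>B\<bar>"
      using min[OF zK t] B[OF zK] B[OF yK] unfolding z_def[symmetric] by simp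
    also have "\<dots> < n * m\<^sup>2"
      using n \<open>m > 0\<close> by (simp add: pos_divide_le_eq)
    finally have "norm (y - z) < m"
      using \<open>n > 0\<close> \<open>m > 0\<close> by (simp add: power2_less_imp_less)
    then have yz: "norm (y - z) < r" "norm (y - z) < q"
      by (auto simp: m_def)
    have "t \<noteq> 1"
    proof
      assume "t = 1"
      then have "f a + \<kappa> < f y"
        using yz(2) q[of y] by (simp add: z_def d_def dist_norm)
      moreover have "a \<in> K"
        using in_K[of a a] \<open>r > 0\<close> by simp
      then have "f y - \<kappa> + n * (norm (y - z))\<^sup>2 \<le> f a"
        using min[of a 0] \<open>t = 1\<close> by simp
      moreover have "n * (norm (y - z))\<^sup>2 \<ge> 0"
        using \<open>n > 0\<close> by simp
      ultimately show False
        by linarith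
    qed
    then have t1: "t < 1"
      using t by simp
    define \<zeta> where "\<zeta> = - (2 * n) *\<^sub>R (y - z)"
    \<comment> \<open>Points this close to \<open>y\<close> stay within \<open>r\<close> of
      \<open>z\<close>, hence in \<open>K\<close>, so \<open>y\<close> is a local minimiser for
      fixed \<open>t\<close>.\<close>
    have "\<forall>\<^sub>F y' in at y. dist y' y < r - norm (y - z)"
      unfolding eventually_at using yz(1) by (intro exI[of _ "r - norm (y - z)"]) auto
    then have "\<forall>\<^sub>F y' in at y. f y + n * (norm (y - z))\<^sup>2 \<le> f y' + n * (norm (y' - z))\<^sup>2"
    proof eventually_elim
      case (elim y')
      have "norm (y' - z) \<le> r"
        using elim norm_triangle_ineq[of "y' - y" "y - z"] by (simp add: dist_norm)
      then show ?case
        using min[OF in_K[OF _ z] t, of y'] by (simp add: z_def)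
    qed
    then have "fsubgrad f y \<zeta>"
      unfolding \<zeta>_def by (rule fsubgrad_if_local_min_add_square)
    moreover have "\<kappa> \<le> \<zeta> \<bullet> d"
    proof (rule ccontr)
      assume less: "\<not> ?thesis"
      \<comment> \<open>Raising \<open>t\<close> by \<open>s\<close> changes \<open>\<Phi>\<close>
        by \<open>s * (\<zeta> \<bullet> d - \<kappa> + s * (n * (norm d)\<^sup>2))\<close>. This
        \<open>s\<close> keeps the quadratic term within half of the gap
        \<open>\<kappa> - \<zeta> \<bullet> d\<close>; \<open>1 - t\<close> keeps
        \<open>t + s\<close> in the unit interval, and \<open>+ 1\<close> keeps the denominator
        positive even for \<open>d = 0\<close>.\<close>
      define s where "s = min (1 - t) ((\<kappa> - \<zeta> \<bullet> d) / (2 * (n * (norm d)\<^sup>2 + 1)))"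
      have pos: "n * (norm d)\<^sup>2 + 1 > 0"
        using \<open>n > 0\<close> by (simp add: add_nonneg_pos)
      have s: "s > 0" "s \<le> 1 - t"
        using pos t1 less by (auto simp: s_def)
      have "y - (a + (t + s) *\<^sub>R d) = (y - z) - s *\<^sub>R d"
        by (simp add: z_def algebra_simps)
      then have "n * (norm (y - (a + (t + s) *\<^sub>R d)))\<^sup>2 =
          n * (norm (y - z))\<^sup>2 + s * (\<zeta> \<bullet> d) + s * (s * (n * (norm d)\<^sup>2))"
        unfolding \<zeta>_def
        by (simp add: power2_norm_eq_inner algebra_simps inner_commute)
      then have "s * \<kappa> \<le> s * (\<zeta> \<bullet> d + s * (n * (norm d)\<^sup>2))"
        using min[OF yK, of "t + s"] s t by (simp add: algebra_simps)
      then have "\<kappa> - \<zeta> \<bullet> d \<le> s * (n * (norm d)\<^sup>2)"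
        using s by simp
      also have "\<dots> \<le> s * (n * (norm d)\<^sup>2 + 1)"
        using s by simp
      also have "\<dots> \<le> (\<kappa> - \<zeta> \<bullet> d) / (2 * (n * (norm d)\<^sup>2 + 1)) * (n * (norm d)\<^sup>2 + 1)"
        using pos by (intro mult_right_mono) (auto simp: s_def)
      also have "\<dots> = (\<kappa> - \<zeta> \<bullet> d) / 2"
        using pos by (simp add: field_simps)
      finally show False
        using less by simp
    qed
    ultimately have "\<zeta> = - (2 * n) *\<^sub>R (y - (a + t *\<^sub>R (b - a))) \<and>
        fsubgrad f y \<zeta> \<and> \<kappa> \<le> \<zeta> \<bullet> (b - a)"
      by (simp add: \<zeta>_def z_def d_def)
    moreover have "y \<in> S" "t \<in> {0..<1}"
      using yK K t t1 by auto
    ultimately show "\<exists>y\<in>S. \<exists>t\<in>{0..<1}.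
        \<exists>\<zeta>. \<zeta> = - (2 * n) *\<^sub>R (y - (a + t *\<^sub>R (b - a))) \<and>
          fsubgrad f y \<zeta> \<and> \<kappa> \<le> \<zeta> \<bullet> (b - a)"
      by blast
  qed
qed

section \<open>Convexity from a monotone subdifferential\<close>

text \<open>A continuous function may have no subgradient at a prescribed point such as
  \<open>c\<close>; the approximate mean value theorem supplies some near the two pieces of the
  segment.\<close>

lemma convex_on_if_fsubgrad_monotone:
  fixes f :: "'a::euclidean_space \<Rightarrow> real"
  assumes "open S" and "convex S" and cont: "continuous_on S f"
    and mono: "\<And>x y \<zeta> \<eta>. \<lbrakk>x \<in> S; y \<in> S; fsubgrad f x \<zeta>; fsubgrad f y \<eta>\<rbrakk> \<Longrightarrow>
      (\<zeta> - \<eta>) \<bullet> (x - y) \<ge> 0"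
  shows "convex_on S f"
proof (rule convex_onI[OF _ \<open>convex S\<close>], rule ccontr)
  fix t a b
  assume t: "0 < t" "t < (1::real)" and ab: "a \<in> S" "b \<in> S"
  define c where "c = (1 - t) *\<^sub>R a + t *\<^sub>R b"
  define \<delta> where "\<delta> = f c - ((1 - t) * f a + t * f b)"
  assume "\<not> f ((1 - t) *\<^sub>R a + t *\<^sub>R b) \<le> (1 - t) * f a + t * f b"
  then have "\<delta> > 0"
    by (simp add: \<delta>_def c_def)
  have ca: "c - a = t *\<^sub>R (b - a)" and cb: "c - b = - (1 - t) *\<^sub>R (b - a)"
    by (simp_all add: c_def algebra_simps)
  have "c \<in> S"
    using t ab \<open>convex S\<close> by (auto simp: c_def convex_alt)
  then have seg: "closed_segment a c \<subseteq> S" "closed_segment b c \<subseteq> S"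
    using ab \<open>convex S\<close> by (auto simp: closed_segment_subset)
  \<comment> \<open>The increments of \<open>f\<close> from \<open>a\<close> and from
    \<open>b\<close> to \<open>c\<close>, each lowered by \<open>\<delta> / 2\<close>. The slopes
    per unit of \<open>b - a\<close> then satisfy \<open>\<kappa> / t + \<mu> / (1 - t) > 0\<close>,
    as the chord parts cancel.\<close>
  define \<kappa> where "\<kappa> = t * (f b - f a) + \<delta> / 2"
  define \<mu> where "\<mu> = (1 - t) * (f a - f b) + \<delta> / 2"
  have "f c = (1 - t) * f a + t * f b + \<delta>"
    by (simp add: \<delta>_def)
  then have "f a + \<kappa> < f c" "f b + \<mu> < f c"
    using \<open>\<delta> > 0\<close> by (auto simp: \<kappa>_def \<mu>_def algebra_simps)
  then obtain N1 N2 where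
    N1: "\<forall>n\<ge>N1. \<exists>y\<in>S. \<exists>t\<in>{0..<1}. \<exists>\<zeta>. \<zeta> = - (2 * n) *\<^sub>R (y - (a + t *\<^sub>R (c - a))) \<and>
      fsubgrad f y \<zeta> \<and> \<kappa> \<le> \<zeta> \<bullet> (c - a)" and
    N2: "\<forall>n\<ge>N2. \<exists>y\<in>S. \<exists>t\<in>{0..<1}. \<exists>\<zeta>. \<zeta> = - (2 * n) *\<^sub>R (y - (b + t *\<^sub>R (c - b))) \<and>
      fsubgrad f y \<zeta> \<and> \<mu> \<le> \<zeta> \<bullet> (c - b)"
    using approximate_mean_value[OF \<open>open S\<close> cont seg(1)]
      approximate_mean_value[OF \<open>open S\<close> cont seg(2)] by metis
  \<comment> \<open>With the same penalty \<open>n\<close> on both sides, the deviations \<open>u\<close>, \<open>u'\<close> from the segment contribute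
    \<open>- 2 n \<bar>u - u'\<bar>\<^sup>2\<close> to the monotonicity product, so no bound on the subgradients is needed.\<close>
  define n where "n = max 0 (max N1 N2)"
  have n: "n \<ge> 0" "n \<ge> N1" "n \<ge> N2"
    by (auto simp: n_def)
  obtain y s \<zeta> where y: "y \<in> S" and s: "s \<in> {0..<1}"
    and \<zeta>: "\<zeta> = - (2 * n) *\<^sub>R (y - (a + s *\<^sub>R (c - a)))" "fsubgrad f y \<zeta>" "\<kappa> \<le> \<zeta> \<bullet> (c - a)"
    using N1[rule_format, OF n(2)] by blast
  obtain y' s' \<eta> where y': "y' \<in> S" and s': "s' \<in> {0..<1}"
    and \<eta>: "\<eta> = - (2 * n) *\<^sub>R (y' - (b + s' *\<^sub>R (c - b)))" "fsubgrad f y' \<eta>" "\<mu> \<le> \<eta> \<bullet> (c - b)"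
    using N2[rule_format, OF n(3)] by blast
  define D where "D = (\<zeta> - \<eta>) \<bullet> (b - a)"
  define u where "u = y - (a + s *\<^sub>R (c - a))"
  define u' where "u' = y' - (b + s' *\<^sub>R (c - b))"
  \<comment> \<open>\<open>\<tau> *\<^sub>R (b - a)\<close> is the displacement between the two base
    points on the segment; it is positive because \<open>s\<close> and \<open>s'\<close> are below
    1.\<close>
  define \<tau> where "\<tau> = 1 - s * t - s' * (1 - t)"
  have "\<zeta> \<bullet> (b - a) \<ge> \<kappa> / t"
    using \<zeta>(3) t by (simp add: ca pos_divide_le_eq mult.commute)
  moreover have "- (\<eta> \<bullet> (b - a)) \<ge> \<mu> / (1 - t)"
  proof -
    have "\<eta> \<bullet> (c - b) = - (\<eta> \<bullet> (b - a)) * (1 - t)"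
      unfolding cb by (simp only: inner_scaleR_right mult_minus_left mult.commute)
    then show ?thesis
      using \<eta>(3) t by (simp only: pos_divide_le_eq diff_gt_0_iff_gt)
  qed
  moreover have "\<kappa> / t + \<mu> / (1 - t) > 0"
    using t \<open>\<delta> > 0\<close> by (simp add: \<kappa>_def \<mu>_def add_divide_distrib add_pos_pos)
  ultimately have "D > 0"
    unfolding D_def inner_diff_left by linarith
  have "s * t < t" "s' * (1 - t) < 1 - t"
    using s s' t by auto
  then have "\<tau> > 0"
    unfolding \<tau>_def by linarith
  have yy: "y - y' = (u - u') - \<tau> *\<^sub>R (b - a)"
    unfolding u_def u'_def \<tau>_def ca cb by (simp add: algebra_simps)
  have "\<zeta> - \<eta> = - (2 * n) *\<^sub>R (u - u')"
    unfolding \<zeta>(1) \<eta>(1) u_def u'_def by (simp add: algebra_simps)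
  then have "(\<zeta> - \<eta>) \<bullet> (u - u') \<le> 0"
    using n by simp
  moreover have "\<tau> * D > 0"
    using \<open>D > 0\<close> \<open>\<tau> > 0\<close> by simp
  ultimately have "(\<zeta> - \<eta>) \<bullet> (y - y') < 0"
    unfolding yy inner_diff_right[of _ "u - u'"] by (simp add: D_def)
  then show False
    using mono[OF y y' \<zeta>(2) \<eta>(2)] by simp
qed

section \<open>Monotone differentiable vector fields\<close>

text \<open>Reduction to lines: \<open>G (x + s *\<^sub>R v) \<bullet> v\<close> has the derivative
  \<open>v \<bullet> G' (x + s *\<^sub>R v) v\<close> in \<open>s\<close>, and monotonicity of
  \<open>G\<close> says that these functions of \<open>s\<close> are nondecreasing.\<close>

lemma monotone_iff_derivative_nonneg:
  fixes G :: "'a::real_inner \<Rightarrow> 'a"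
  assumes "open S" and "convex S" and G: "\<And>x. x \<in> S \<Longrightarrow> (G has_derivative G' x) (at x)"
  shows "(\<forall>x\<in>S. \<forall>y\<in>S. (G x - G y) \<bullet> (x - y) \<ge> 0) \<longleftrightarrow> (\<forall>x\<in>S. \<forall>v. v \<bullet> G' x v \<ge> 0)"
proof -
  have deriv: "DERIV (\<lambda>s. G (x + s *\<^sub>R v) \<bullet> v) s :> v \<bullet> G' (x + s *\<^sub>R v) v"
    if "x + s *\<^sub>R v \<in> S" for x v s
  proof -
    have "((\<lambda>s. x + s *\<^sub>R v) has_derivative (\<lambda>k. k *\<^sub>R v)) (at s)"
      by (auto intro!: derivative_eq_intros)
    from has_derivative_compose[OF this G[OF that]]
    have "((\<lambda>s. G (x + s *\<^sub>R v)) has_derivative (\<lambda>k. G' (x + s *\<^sub>R v) (k *\<^sub>R v))) (at s)" .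
    moreover have "linear (G' (x + s *\<^sub>R v))"
      using G[OF that] by (rule has_derivative_linear)
    ultimately have "((\<lambda>s. G (x + s *\<^sub>R v)) has_vector_derivative G' (x + s *\<^sub>R v) v) (at s)"
      unfolding has_vector_derivative_def by (simp add: linear_cmul)
    from bounded_linear.has_vector_derivative[OF bounded_linear_inner_left this, of v]
    show ?thesis
      unfolding has_real_derivative_iff_has_vector_derivative by (simp add: inner_commute)
  qed
  show ?thesis
  proof (intro iffI ballI allI)
    fix x v
    assume mono: "\<forall>x\<in>S. \<forall>y\<in>S. (G x - G y) \<bullet> (x - y) \<ge> 0" and x: "x \<in> S"
    show "v \<bullet> G' x v \<ge> 0"
    proof (rule ccontr)
      assume "\<not> ?thesis"
      then obtain d where "d > 0" and
        d: "\<And>k. \<lbrakk>0 < k; k < d\<rbrakk> \<Longrightarrow> G (x + k *\<^sub>R v) \<bullet> v < G x \<bullet> v"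
        using DERIV_neg_dec_right[OF deriv[of x 0 v]] x by auto
      \<comment> \<open>Monotonicity applies only inside \<open>S\<close>, so \<open>k\<close> must
        also be small enough for \<open>x + k *\<^sub>R v\<close> to stay there.\<close>
      have "isCont (\<lambda>k. x + k *\<^sub>R v) 0"
        by (intro continuous_intros)
      then have "((\<lambda>k. x + k *\<^sub>R v) \<longlongrightarrow> x) (at_right 0)"
        by (simp add: isCont_def filterlim_at_split)
      then have "\<forall>\<^sub>F k in at_right 0. x + k *\<^sub>R v \<in> S"
        using \<open>open S\<close> x topological_tendstoD by blast
      moreover have "\<forall>\<^sub>F k in at_right 0. k \<in> {0<..<d}"
        using \<open>d > 0\<close> by (rule eventually_at_right_real)
      ultimately have "\<forall>\<^sub>F k in at_right 0. x + k *\<^sub>R v \<in> S \<and> k \<in> {0<..<d}"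
        by (rule eventually_conj)
      then obtain k where k: "x + k *\<^sub>R v \<in> S" "0 < k" "k < d"
        using eventually_happens'[OF trivial_limit_at_right_real] by fastforce
      then have "k * ((G (x + k *\<^sub>R v) - G x) \<bullet> v) \<ge> 0"
        using mono[rule_format, OF k(1) x] by simp
      then show False
        using d[OF k(2,3)] k(2) by (simp add: zero_le_mult_iff inner_diff_left)
    qed
  next
    fix x y
    assume psd: "\<forall>x\<in>S. \<forall>v. v \<bullet> G' x v \<ge> 0" and xy: "x \<in> S" "y \<in> S"
    have seg: "y + s *\<^sub>R (x - y) \<in> S" if "0 \<le> s" "s \<le> 1" for s
    proof -
      have "y + s *\<^sub>R (x - y) = (1 - s) *\<^sub>R y + s *\<^sub>R x"
        by (simp add: algebra_simps)
      then show ?thesis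
        using that xy \<open>convex S\<close> by (simp add: convex_alt)
    qed
    have "G (y + 0 *\<^sub>R (x - y)) \<bullet> (x - y) \<le> G (y + 1 *\<^sub>R (x - y)) \<bullet> (x - y)"
      by (rule DERIV_nonneg_imp_nondecreasing[of 0 1 "\<lambda>s. G (y + s *\<^sub>R (x - y)) \<bullet> (x - y)"])
        (use deriv[OF seg] psd seg in \<open>auto intro!: exI\<close>)
    then show "(G x - G y) \<bullet> (x - y) \<ge> 0"
      by (simp add: inner_diff_left)
  qed
qed

section \<open>Smooth shifts and the extended-real notions\<close>

text \<open>One direction is the sum rule, the other the sum rule with \<open>- g\<close>, for which
  \<open>- \<eta>\<close> is a subgradient as well.\<close>

lemma fsubgrad_add_GDERIV_iff:
  assumes "GDERIV g x :> \<eta>"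
  shows "fsubgrad (\<lambda>y. f y + g y) x (\<zeta> + \<eta>) \<longleftrightarrow> fsubgrad f x \<zeta>"
proof
  assume "fsubgrad (\<lambda>y. f y + g y) x (\<zeta> + \<eta>)"
  then have "fsubgrad (\<lambda>y. f y + g y + - g y) x (\<zeta> + \<eta> + - \<eta>)"
    by (rule fsubgrad_add[OF _ GDERIV_imp_fsubgrad[OF GDERIV_minus[OF assms]]])
  then show "fsubgrad f x \<zeta>"
    by simp
qed (use assms in \<open>blast intro: fsubgrad_add GDERIV_imp_fsubgrad\<close>)

lemma frechet_subdiff_iff_fsubgrad:
  fixes f :: "real^'n \<Rightarrow> ereal"
  assumes "open S" and "x \<in> S" and fin: "\<And>y. y \<in> S \<Longrightarrow> f y = ereal (F y)"
  shows "\<zeta> \<in> frechet_subdiff f x \<longleftrightarrow> fsubgrad F x \<zeta>"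
proof -
  have nearby: "\<forall>\<^sub>F y in at x. y \<in> S"
    using assms(1,2) by (rule eventually_at_in_open')
  show ?thesis
  proof
    assume "\<zeta> \<in> frechet_subdiff f x"
    then obtain r where r: "r \<in> o[at x](\<lambda>y. norm (y - x))"
      and ge: "\<forall>\<^sub>F y in at x. f y \<ge> f x + ereal (\<zeta> \<bullet> (y - x)) + ereal (r y)"
      by (auto simp: frechet_subdiff_def)
    show "fsubgrad F x \<zeta>"
      unfolding fsubgrad_def
    proof (intro allI impI)
      fix e :: real
      assume "e > 0"
      from landau_o.smallD[OF r this] ge nearby
      show "\<forall>\<^sub>F y in at x. F x + \<zeta> \<bullet> (y - x) - e * norm (y - x) \<le> F y"
        by eventually_elim (use fin \<open>x \<in> S\<close> in auto)
    qed
  next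
    assume sub: "fsubgrad F x \<zeta>"
    \<comment> \<open>Only the negative part of the linearisation error: \<open>fsubgrad\<close>
      bounds the error from below, and the positive part need not be small.\<close>
    define r where "r y = min 0 (F y - F x - \<zeta> \<bullet> (y - x))" for y
    have "r \<in> o[at x](\<lambda>y. norm (y - x))"
    proof (rule landau_o.smallI)
      fix e :: real
      assume "e > 0"
      then have "\<forall>\<^sub>F y in at x. F x + \<zeta> \<bullet> (y - x) - e * norm (y - x) \<le> F y"
        using sub by (simp add: fsubgrad_def)
      then show "\<forall>\<^sub>F y in at x. norm (r y) \<le> e * norm (norm (y - x))"
        by eventually_elim (use \<open>e > 0\<close> in \<open>auto simp: r_def min_def\<close>)
    qed
    moreover from nearby have "\<forall>\<^sub>F y in at x. f y \<ge> f x + ereal (\<zeta> \<bullet> (y - x)) + ereal (r y)"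
      by eventually_elim (use fin \<open>x \<in> S\<close> in \<open>auto simp: r_def min_def\<close>)
    ultimately show "\<zeta> \<in> frechet_subdiff f x"
      using fin \<open>x \<in> S\<close> by (auto simp: frechet_subdiff_def edom_def)
  qed
qed

text \<open>The gradient is the Riesz representative \<open>adjoint D 1\<close> of the derivative;
  uniqueness makes the description in \<open>grad\<close> denote it.\<close>

lemma GDERIV_grad:
  assumes "(\<lambda>y. real_of_ereal (f y)) differentiable (at x)"
  shows "GDERIV (\<lambda>y. real_of_ereal (f y)) x :> grad f x"
proof -
  obtain D where D: "((\<lambda>y. real_of_ereal (f y)) has_derivative D) (at x)"
    using assms by (auto simp: differentiable_def)
  have "D = (\<lambda>k. k \<bullet> adjoint D 1)"
    using adjoint_works[OF has_derivative_linear[OF D], of _ 1] by simp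
  then have "GDERIV (\<lambda>y. real_of_ereal (f y)) x :> adjoint D 1"
    using D by (simp add: gderiv_def)
  then show ?thesis
    unfolding grad_def by (rule theI) (blast intro: fsubgrad_unique GDERIV_imp_fsubgrad \<open>GDERIV _ x :> _\<close>)
qed

lemma has_derivative_hessian:
  assumes "C2_on f S" and "x \<in> S"
  shows "(grad f has_derivative (\<lambda>v. hessian f x *v v)) (at x)"
  using assms unfolding C2_on_def hessian_def by (metis jacobian_works)

text \<open>Convexity of \<open>S\<close> keeps convex combinations in \<open>S\<close>, so every
  value involved is finite.\<close>

lemma econvex_on_ereal_iff:
  assumes "\<And>x. x \<in> S \<Longrightarrow> f x = ereal (F x)"
  shows "econvex_on S f \<longleftrightarrow> convex_on S F"
proof -
  have "(f (u *\<^sub>R x + v *\<^sub>R y) \<le> ereal u * f x + ereal v * f y) \<longleftrightarrow>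
      F (u *\<^sub>R x + v *\<^sub>R y) \<le> u * F x + v * F y"
    if "convex S" "x \<in> S" "y \<in> S" "u \<ge> 0" "v \<ge> 0" "u + v = 1" for x y u v
    using convexD[OF that(1,2,3,4,5,6)] that assms by simp
  then show ?thesis
    unfolding econvex_on_def convex_on_def by (auto cong: conj_cong)
qed

section \<open>The equivalences for relative weak convexity\<close>

theorem proposition3p8:
  fixes h \<phi> :: "real^'n \<Rightarrow> ereal" and S :: "(real^'n) set" and \<rho> :: real
  assumes "kernel_function h"
    and "S \<subseteq> interior (edom h)" and "S \<noteq> {}" and "convex S" and "open S"
    and "\<rho> > 0"
    and "proper \<phi>"
    and "\<forall>x\<in>S. locally_lipschitz_at \<phi> x"
  shows "(weakly_convex_rel \<rho> h S \<phi> \<longleftrightarrow>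
      (\<forall>x\<in>S. \<forall>y\<in>S. \<forall>\<zeta>\<in>frechet_subdiff \<phi> x.
        \<phi> y \<ge> \<phi> x + ereal (\<zeta> \<bullet> (y - x)) - ereal \<rho> * bregman h y x)) \<and>
    (weakly_convex_rel \<rho> h S \<phi> \<longleftrightarrow>
      (\<forall>x\<in>S. \<forall>y\<in>S. \<forall>\<zeta>\<in>frechet_subdiff \<phi> x. \<forall>\<eta>\<in>frechet_subdiff \<phi> y.
        (\<zeta> - \<eta>) \<bullet> (x - y) \<ge> - \<rho> * ((grad h x - grad h y) \<bullet> (x - y)))) \<and>
    (C2_on \<phi> S \<and> C2_on h S \<longrightarrow>
      (weakly_convex_rel \<rho> h S \<phi> \<longleftrightarrow>
        (\<forall>x\<in>S. hessian \<phi> x \<succeq>\<^sub>L - (\<rho> *\<^sub>R hessian h x))))"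
    (is "(?a \<longleftrightarrow> ?b) \<and> (?a \<longleftrightarrow> ?c) \<and> (?smooth \<longrightarrow> (?a \<longleftrightarrow> ?d))")
proof -
  define F where "F y = real_of_ereal (\<phi> y)" for y
  define H where "H y = real_of_ereal (h y)" for y
  define P where "P y = F y + \<rho> * H y" for y
  \<comment> \<open>Finiteness on \<open>S\<close> is part of
    \<open>locally_lipschitz_at\<close>.\<close>
  have \<phi>F: "\<phi> y = ereal (F y)" if "y \<in> S" for y
  proof -
    have "\<bar>\<phi> y\<bar> \<noteq> \<infinity>"
      using assms(8) that unfolding locally_lipschitz_at_def by metis
    then show ?thesis
      by (simp add: F_def ereal_real)
  qed
  have hH: "h y = ereal (H y)" if "y \<in> S" for y
    using assms(1,2) that interior_subset[of "edom h"]
    by (auto simp: H_def kernel_function_def proper_def edom_def ereal_real)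
  have gradH: "GDERIV H x :> grad h x" if "x \<in> S" for x
    using assms(1,2) that GDERIV_grad[of h x]
    unfolding kernel_function_def C1_on_def H_def by blast
  have grad\<rho>H: "GDERIV (\<lambda>y. \<rho> * H y) x :> \<rho> *\<^sub>R grad h x" if "x \<in> S" for x
    using GDERIV_mult[OF GDERIV_const gradH[OF that]] by simp
  have subF: "\<zeta> \<in> frechet_subdiff \<phi> x \<longleftrightarrow> fsubgrad F x \<zeta>" if "x \<in> S" for x \<zeta>
    using \<open>open S\<close> that \<phi>F by (rule frechet_subdiff_iff_fsubgrad)
  have subP: "fsubgrad P x (\<zeta> + \<rho> *\<^sub>R grad h x) \<longleftrightarrow> \<zeta> \<in> frechet_subdiff \<phi> x"
    if "x \<in> S" for x \<zeta>
    using fsubgrad_add_GDERIV_iff[OF grad\<rho>H[OF that], of F] subF[OF that]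
    by (simp add: P_def[abs_def])
  have "isCont P x" if x: "x \<in> S" for x
  proof -
    obtain U L where "open U" "x \<in> U" "L-lipschitz_on U F"
      using assms(8) x unfolding locally_lipschitz_at_def F_def by blast
    then have "isCont F x"
      by (metis lipschitz_on_continuous_on continuous_on_eq_continuous_at)
    moreover have "isCont H x"
      using gradH[OF x] unfolding gderiv_def by (rule has_derivative_continuous)
    ultimately show ?thesis
      unfolding P_def by (intro continuous_intros)
  qed
  then have contP: "continuous_on S P"
    by (simp add: continuous_at_imp_continuous_on)
  have a: "?a \<longleftrightarrow> convex_on S P"
    unfolding weakly_convex_rel_def
    by (rule econvex_on_ereal_iff) (simp add: \<phi>F hH P_def)
  \<comment> \<open>As \<open>x\<close> is in the interior of the domain of \<open>h\<close>, the
    Bregman distance is finite and its terms regroup into \<open>P\<close>.\<close>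
  have b: "\<phi> y \<ge> \<phi> x + ereal (\<zeta> \<bullet> (y - x)) - ereal \<rho> * bregman h y x \<longleftrightarrow>
      P x + (\<zeta> + \<rho> *\<^sub>R grad h x) \<bullet> (y - x) \<le> P y" if "x \<in> S" "y \<in> S" for x y \<zeta>
  proof -
    have "bregman h y x = ereal (H y - H x - grad h x \<bullet> (y - x))"
      using that assms(2) by (auto simp: bregman_def hH)
    then show ?thesis
      using that by (simp add: \<phi>F P_def inner_add_left algebra_simps)
  qed
  have c: "(\<zeta> - \<eta>) \<bullet> (x - y) \<ge> - \<rho> * ((grad h x - grad h y) \<bullet> (x - y)) \<longleftrightarrow>
      ((\<zeta> + \<rho> *\<^sub>R grad h x) - (\<eta> + \<rho> *\<^sub>R grad h y)) \<bullet> (x - y) \<ge> 0" for x y \<zeta> \<eta>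
    by (simp add: algebra_simps)
  have "?b" if ?a
    using that a b subP fsubgrad_convex_above_tangent[of S P] by blast
  \<comment> \<open>Adding the subgradient inequalities from \<open>x\<close> to \<open>y\<close>
    and from \<open>y\<close> to \<open>x\<close> cancels the values of \<open>P\<close>.\<close>
  moreover have "?c" if ?b
  proof (intro ballI)
    fix x y \<zeta> \<eta>
    assume xy: "x \<in> S" "y \<in> S" "\<zeta> \<in> frechet_subdiff \<phi> x" "\<eta> \<in> frechet_subdiff \<phi> y"
    then have "P x + (\<zeta> + \<rho> *\<^sub>R grad h x) \<bullet> (y - x) \<le> P y"
      and "P y + (\<eta> + \<rho> *\<^sub>R grad h y) \<bullet> (x - y) \<le> P x"
      using that b by blast+
    then show "(\<zeta> - \<eta>) \<bullet> (x - y) \<ge> - \<rho> * ((grad h x - grad h y) \<bullet> (x - y))"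
      unfolding c by (simp add: algebra_simps)
  qed
  moreover have "?a" if ?c
    unfolding a
  proof (rule convex_on_if_fsubgrad_monotone[OF \<open>open S\<close> \<open>convex S\<close> contP])
    fix x y \<zeta> \<eta>
    assume xy: "x \<in> S" "y \<in> S" "fsubgrad P x \<zeta>" "fsubgrad P y \<eta>"
    then have "\<zeta> - \<rho> *\<^sub>R grad h x \<in> frechet_subdiff \<phi> x" "\<eta> - \<rho> *\<^sub>R grad h y \<in> frechet_subdiff \<phi> y"
      using subP by (metis diff_add_cancel)+
    from that[rule_format, OF xy(1,2) this]
    show "(\<zeta> - \<eta>) \<bullet> (x - y) \<ge> 0"
      unfolding c by simp
  qed
  ultimately have ab: "?a \<longleftrightarrow> ?b" and ac: "?a \<longleftrightarrow> ?c"
    by blast+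
  moreover have "?a \<longleftrightarrow> ?d" if ?smooth
  proof -
    \<comment> \<open>The gradient of \<open>P\<close>; once the subdifferentials of
      \<open>\<phi>\<close> are singletons, (c) is the monotonicity of \<open>G\<close>.\<close>
    define G where "G x = grad \<phi> x + \<rho> *\<^sub>R grad h x" for x
    have "GDERIV F x :> grad \<phi> x" if "x \<in> S" for x
      using \<open>?smooth\<close> that GDERIV_grad[of \<phi> x] unfolding C2_on_def C1_on_def F_def by blast
    then have "frechet_subdiff \<phi> x = {grad \<phi> x}" if "x \<in> S" for x
      using that subF GDERIV_imp_fsubgrad fsubgrad_unique by blast
    then have "?c \<longleftrightarrow> (\<forall>x\<in>S. \<forall>y\<in>S. (G x - G y) \<bullet> (x - y) \<ge> 0)"
      unfolding c G_def by simp
    moreover have "(G has_derivative (\<lambda>v. hessian \<phi> x *v v + \<rho> *\<^sub>R (hessian h x *v v))) (at x)"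
      if "x \<in> S" for x
      unfolding G_def using \<open>?smooth\<close> that
      by (intro has_derivative_add has_derivative_scaleR_right has_derivative_hessian) auto
    then have "(\<forall>x\<in>S. \<forall>y\<in>S. (G x - G y) \<bullet> (x - y) \<ge> 0) \<longleftrightarrow>
        (\<forall>x\<in>S. \<forall>v. v \<bullet> (hessian \<phi> x *v v + \<rho> *\<^sub>R (hessian h x *v v)) \<ge> 0)"
      by (rule monotone_iff_derivative_nonneg[OF \<open>open S\<close> \<open>convex S\<close>])
    moreover have "\<dots> \<longleftrightarrow> ?d"
      by (simp add: loewner_ge_def matrix_vector_mult_add_rdistrib scaleR_matrix_vector_assoc)
    ultimately show ?thesis
      using ac by blast
  qed
  ultimately show ?thesis
    by blast
qed

end
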